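(* Let $\mathcal S=\bigcup_{i=1}^{N}\mathcal P_i\subset\mathbb{R}^n$ be a union of $N$ convex polytopes given in vertex representation with a total of $n_v$ vertices; that is, there are points $v_1,\dots,v_{n_v}\in\mathbb{R}^n$ such that each $\mathcal P_i$ is the convex hull of a subset of $\{v_1,\dots,v_{n_v}\}$. Then $\mathcal S$ can be represented as a hybrid zonotope with memory complexity $$n_g=2n_v,\qquad n_b=N,\qquad n_c=n_v+2,$$ i.e. there exist $G^c\in\mathbb{R}^{n\times n_g}$, $G^b\in\mathbb{R}^{n\times n_b}$, $c\in\mathbb{R}^n$, $A^c\in\mathbb{R}^{n_c\times n_g}$, $A^b\in\mathbb{R}^{n_c\times n_b}$, $b\in\mathbb{R}^{n_c}$ with these values of $n_g,n_b,n_c$ such that $\mathcal S=\langle G^c,G^b,c,A^c,A^b,b\rangle$.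
   Context: A set is a hybrid zonotope in $\mathbb{R}^n$, written $\langle G^c,G^b,c,A^c,A^b,b\rangle$ with $G^c\in\mathbb{R}^{n\times n_g}$, $G^b\in\mathbb{R}^{n\times n_b}$, $c\in\mathbb{R}^n$, $A^c\in\mathbb{R}^{n_c\times n_g}$, $A^b\in\mathbb{R}^{n_c\times n_b}$, $b\in\mathbb{R}^{n_c}$, if it equals $$\left\{G^c\xi^c+G^b\xi^b+c\ \middle|\ \xi^c\in[-1,1]^{n_g},\ \xi^b\in\{-1,1\}^{n_b},\ A^c\xi^c+A^b\xi^b=b\right\}.$$ The numbers $n_g$ (continuous generators), $n_b$ (binary generators) and $n_c$ (constraints) are its memory complexity. A convex polytope in vertex representation is a set $\{V\lambda\mid\lambda_j\ge0\ \forall j,\ \mathbf 1^T\lambda=1\}$ where the finitely many columns of $V$ are its vertices. Vertices may be shared between several polytopes $\mathcal P_i$ of the collection, being then counted once in $n_v$. *)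

theory Defs
  imports "Jordan_Normal_Form.Matrix"
begin

text \<open>The polytope with vertex matrix \<open>V\<close>: all convex combinations of the columns of \<open>V\<close>.
  The columns are neither required to be distinct nor to be extreme points, and the polytope is
  empty if \<open>V\<close> has no column.\<close>

definition vrep_polytope :: "real mat \<Rightarrow> real vec set" where
  "vrep_polytope V =
     {V *\<^sub>v l | l. l \<in> carrier_vec (dim_col V) \<and>
                  (\<forall>j < dim_col V. 0 \<le> l $ j) \<and>
                  (\<Sum>j < dim_col V. l $ j) = 1}"

text \<open>The arguments are meant to have compatible dimensions: for \<open>n\<close> the ambient dimension,
  \<open>Gc\<close> is \<open>n \<times> ng\<close>, \<open>Gb\<close> is \<open>n \<times> nb\<close>, \<open>c\<close> has length \<open>n\<close>,
  \<open>Ac\<close> is \<open>nc \<times> ng\<close>, \<open>Ab\<close> is \<open>nc \<times> nb\<close> and \<open>b\<close> has length \<open>nc\<close>.\<close>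

definition hybrid_zonotope ::
  "real mat \<Rightarrow> real mat \<Rightarrow> real vec \<Rightarrow> real mat \<Rightarrow> real mat \<Rightarrow> real vec \<Rightarrow> real vec set" where
  "hybrid_zonotope Gc Gb c Ac Ab b =
     {Gc *\<^sub>v xc + Gb *\<^sub>v xb + c | xc xb.
        xc \<in> carrier_vec (dim_col Gc) \<and> (\<forall>j < dim_col Gc. xc $ j \<in> {-1..1}) \<and>
        xb \<in> carrier_vec (dim_col Gb) \<and> (\<forall>j < dim_col Gb. xb $ j \<in> {-1, 1}) \<and>
        Ac *\<^sub>v xc + Ab *\<^sub>v xb = b}"

end

theory Submission
  imports Defs
begin

text \<open>Write \<open>J i\<close> for the set of indices of the vertices of the \<open>i\<close>-th polytope. After rescaling
  \<open>[-1,1]\<close> to \<open>[0,1]\<close>, the factors become weights \<open>\<lambda>\<^sub>j\<close> and slacks \<open>s\<^sub>j\<close> (continuous)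
  and selectors \<open>\<delta>\<^sub>i\<close> (binary), subject to \<open>\<Sum>\<^sub>j \<lambda>\<^sub>j = 1\<close>, \<open>\<Sum>\<^sub>i \<delta>\<^sub>i = 1\<close> and
  \<open>\<lambda>\<^sub>j + s\<^sub>j = \<Sum>\<^sub>i [j \<in> J i] \<delta>\<^sub>i\<close>. Exactly one selector is active, and the last constraint then says
  that \<open>\<lambda>\<close> is supported on the vertices of the selected polytope.\<close>

text \<open>All polytopes draw on one common family \<open>w\<close>, so each is given by its index
  set alone. The points are written by coordinates because the vectors carry no dimension in their
  type.\<close>

definition convex_combinations :: "nat \<Rightarrow> (nat \<Rightarrow> real vec) \<Rightarrow> nat set \<Rightarrow> real vec set" where
  "convex_combinations n w J =
     {vec n (\<lambda>r. \<Sum>j\<in>J. \<mu> j * w j $ r) | \<mu>. (\<forall>j\<in>J. 0 \<le> \<mu> j) \<and> sum \<mu> J = 1}"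

lemma vrep_polytope_eq_convex_combinations:
  assumes "V \<in> carrier_mat n k"
  shows "vrep_polytope V = convex_combinations n (col V) {..<k}"
proof -
  have eq: "V *\<^sub>v l = vec n (\<lambda>r. \<Sum>j<k. l $ j * col V j $ r)" if "l \<in> carrier_vec k" for l
    using that assms
    by (intro eq_vecI) (auto simp: scalar_prod_def lessThan_atLeast0 mult.commute intro!: sum.cong)
  show ?thesis
  proof (intro subset_antisym subsetI)
    fix x assume "x \<in> vrep_polytope V"
    then obtain l where l: "l \<in> carrier_vec k" "\<forall>j<k. 0 \<le> l $ j" "(\<Sum>j<k. l $ j) = 1"
      and x: "x = V *\<^sub>v l"
      using assms unfolding vrep_polytope_def by auto
    show "x \<in> convex_combinations n (col V) {..<k}"
      unfolding convex_combinations_def x eq[OF l(1)]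
      using l by (intro CollectI exI[of _ "\<lambda>j. l $ j"]) auto
  next
    fix x assume "x \<in> convex_combinations n (col V) {..<k}"
    then obtain \<mu> where \<mu>: "\<forall>j<k. 0 \<le> \<mu> j" "sum \<mu> {..<k} = 1"
      and x: "x = vec n (\<lambda>r. \<Sum>j<k. \<mu> j * col V j $ r)"
      unfolding convex_combinations_def by auto
    have "x = V *\<^sub>v vec k \<mu>"
      unfolding x by (subst eq) (auto intro!: eq_vecI sum.cong)
    then show "x \<in> vrep_polytope V"
      unfolding vrep_polytope_def using \<mu> assms
      by (intro CollectI exI[of _ "vec k \<mu>"]) auto
  qed
qed

text \<open>Choose \<open>f\<close> with \<open>w j = u (f j)\<close> and give \<open>k\<close> the
  total weight of the fibre of \<open>f\<close> over \<open>k\<close>. The fibres partition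
  \<open>J\<close>, so total weight and point are kept. Only the sets of points matter, so
  repetitions in \<open>w\<close> or \<open>u\<close> are harmless.\<close>

lemma convex_combinations_mono:
  assumes "finite J" "finite K" and sub: "w ` J \<subseteq> u ` K"
  shows "convex_combinations n w J \<subseteq> convex_combinations n u K"
proof
  fix x assume "x \<in> convex_combinations n w J"
  then obtain \<mu> where \<mu>: "\<forall>j\<in>J. 0 \<le> \<mu> j" "sum \<mu> J = 1"
    and x: "x = vec n (\<lambda>r. \<Sum>j\<in>J. \<mu> j * w j $ r)"
    unfolding convex_combinations_def by auto
  have "\<forall>j\<in>J. \<exists>k\<in>K. w j = u k"
    using sub by blast
  then obtain f where f: "\<And>j. j \<in> J \<Longrightarrow> f j \<in> K" "\<And>j. j \<in> J \<Longrightarrow> w j = u (f j)"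
    by metis
  define \<nu> where "\<nu> k = (\<Sum>j | j \<in> J \<and> f j = k. \<mu> j)" for k
  have fib: "(\<Sum>k\<in>K. \<Sum>j | j \<in> J \<and> f j = k. h j) = sum h J" for h :: "nat \<Rightarrow> real"
    using assms f by (intro sum.group) auto
  have "(\<Sum>k\<in>K. \<nu> k * u k $ r) = (\<Sum>j\<in>J. \<mu> j * w j $ r)" for r
    unfolding fib[of "\<lambda>j. \<mu> j * w j $ r", symmetric] \<nu>_def sum_distrib_right
    by (intro sum.cong refl) (auto simp: f)
  then have "x = vec n (\<lambda>r. \<Sum>k\<in>K. \<nu> k * u k $ r)"
    unfolding x by simp
  moreover have "\<forall>k\<in>K. 0 \<le> \<nu> k"
    unfolding \<nu>_def using \<mu> by (auto intro!: sum_nonneg)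
  moreover have "sum \<nu> K = 1"
    unfolding \<nu>_def fib using \<mu> by simp
  ultimately show "x \<in> convex_combinations n u K"
    unfolding convex_combinations_def by blast
qed

text \<open>The columns of \<open>V\<close> and the selected points form the same set, so
  monotonicity applies in both directions. If a point occurs several times in \<open>w\<close>, all
  its indices are selected.\<close>

lemma vrep_polytope_eq_convex_combinations_if_cols:
  assumes V: "V \<in> carrier_mat n k" and cols: "set (cols V) \<subseteq> w ` K" and "finite K"
  shows "vrep_polytope V = convex_combinations n w {j \<in> K. w j \<in> set (cols V)}"
proof -
  have "col V ` {..<k} = set (cols V)"
    using V by (auto simp: cols_def)
  moreover have "w ` {j \<in> K. w j \<in> set (cols V)} = set (cols V)"
    using cols by auto
  ultimately show ?thesis
    unfolding vrep_polytope_eq_convex_combinations[OF V] using \<open>finite K\<close>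
    by (intro subset_antisym convex_combinations_mono) auto
qed

lemma sum_lessThan_double:
  fixes f :: "nat \<Rightarrow> 'a::comm_monoid_add"
  shows "(\<Sum>j<2 * m. f j) = (\<Sum>j<m. f j) + (\<Sum>j<m. f (m + j))"
proof -
  have "(\<Sum>j<2 * m. f j) = (\<Sum>j<m. f j) + (\<Sum>j=m..<m+m. f j)"
    by (simp add: mult_2 lessThan_atLeast0 sum.atLeastLessThan_concat)
  also have "(\<Sum>j=m..<m+m. f j) = (\<Sum>j<m. f (m + j))"
    using sum.shift_bounds_nat_ivl[of f 0 m m] by (simp add: lessThan_atLeast0 add.commute)
  finally show ?thesis .
qed

text \<open>If \<open>p\<close> of the \<open>N\<close> signs are 1, their sum is
  \<open>2 * p - N\<close>, hence \<open>p = 1\<close>. For \<open>N = 0\<close> the hypothesis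
  reads 0 = 2, so an empty union will match an infeasible constraint.\<close>

lemma signs_sum_singleton:
  fixes x :: "nat \<Rightarrow> real"
  assumes signs: "\<And>i. i < N \<Longrightarrow> x i \<in> {-1, 1}" and sum: "(\<Sum>i<N. x i) = 2 - real N"
  obtains i where "i < N" "\<And>k. k < N \<Longrightarrow> x k = 2 * of_bool (k = i) - 1"
proof -
  have "(\<Sum>i<N. x i) = (\<Sum>i<N. 2 * of_bool (x i = 1) - 1)"
    using signs by (intro sum.cong) force+
  also have "\<dots> = 2 * real (card {i. i < N \<and> x i = 1}) - real N"
    by (simp add: sum_subtractf sum_distrib_left[symmetric] sum.If_cases of_bool_def Int_def)
  finally have "card {i. i < N \<and> x i = 1} = 1"
    using sum by simp
  then obtain i where i: "{i. i < N \<and> x i = 1} = {i}"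
    by (rule card_1_singletonE)
  show ?thesis
  proof
    show "i < N" using i by auto
    show "x k = 2 * of_bool (k = i) - 1" if "k < N" for k
      using i signs[OF that] that by (cases "k = i") auto
  qed
qed

lemma Union_convex_combinations_eq_hybrid_zonotope:
  assumes J: "\<And>i. i < N \<Longrightarrow> J i \<subseteq> {..<m}"
  shows "\<exists>Gc \<in> carrier_mat n (2 * m). \<exists>Gb \<in> carrier_mat n N. \<exists>c \<in> carrier_vec n.
    \<exists>Ac \<in> carrier_mat (m + 2) (2 * m). \<exists>Ab \<in> carrier_mat (m + 2) N. \<exists>b \<in> carrier_vec (m + 2).
      (\<Union>i<N. convex_combinations n w (J i)) = hybrid_zonotope Gc Gb c Ac Ab b"
proof -
  \<comment> \<open>A weight is \<open>(xc $ j + 1) / 2\<close>: the factor 1/2 goes into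
    \<open>Gc\<close> and the shift into \<open>c\<close>. The first \<open>m\<close> continuous
    factors encode weights, the last \<open>m\<close> slacks. The selectors act through the
    constraints only, so \<open>Gb\<close> is zero.\<close>
  define Gc where "Gc = mat n (2 * m) (\<lambda>(r, j). if j < m then w j $ r / 2 else 0)"
  define Gb :: "real mat" where "Gb = 0\<^sub>m n N"
  define c where "c = vec n (\<lambda>r. \<Sum>j<m. w j $ r / 2)"
  \<comment> \<open>Rows below \<open>m\<close> tie weight and slack to the selectors, row
    \<open>m\<close> fixes the sum of the weights, and row \<open>m + 1\<close> the sum of the
    selectors.\<close>
  define Ac :: "real mat" where "Ac = mat (m + 2) (2 * m) (\<lambda>(r, j).
    if r < m then of_bool (j = r) + of_bool (j = m + r) else of_bool (r = m \<and> j < m))"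
  define Ab :: "real mat" where "Ab = mat (m + 2) N (\<lambda>(r, i).
    if r < m then - of_bool (r \<in> J i) else of_bool (r = m + 1))"
  \<comment> \<open>The constants come from putting \<open>(x + 1) / 2\<close> for each weight,
    slack and selector and multiplying by 2; for example, weights summing to 1 become factors
    summing to \<open>2 - real m\<close>.\<close>
  define b :: "real vec" where "b = vec (m + 2) (\<lambda>r.
    if r < m then (\<Sum>i<N. of_bool (r \<in> J i)) - 2 else if r = m then 2 - real m else 2 - real N)"
  note defs = Gc_def Gb_def c_def Ac_def Ab_def b_def
  have point: "Gc *\<^sub>v xc + Gb *\<^sub>v xb + c = vec n (\<lambda>r. \<Sum>j<m. (xc $ j + 1) / 2 * w j $ r)"
    if "xc \<in> carrier_vec (2 * m)" "xb \<in> carrier_vec N" for xc xb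
    using that
    by (intro eq_vecI)
       (auto simp: defs scalar_prod_def lessThan_atLeast0[symmetric] sum_lessThan_double
         sum.distrib[symmetric] add_divide_distrib distrib_right intro!: sum.cong)
  have Ac_slack: "(Ac *\<^sub>v xc) $ r = xc $ r + xc $ (m + r)"
    if "xc \<in> carrier_vec (2 * m)" "r < m" for xc r
    using that
    by (auto simp: defs scalar_prod_def lessThan_atLeast0[symmetric] sum_lessThan_double
        of_bool_def if_distrib[of "\<lambda>x. x * _"] cong: if_cong)
  have Ac_sum: "(Ac *\<^sub>v xc) $ m = (\<Sum>j<m. xc $ j)" "(Ac *\<^sub>v xc) $ Suc m = 0"
    if "xc \<in> carrier_vec (2 * m)" for xc
    using that
    by (auto simp: defs scalar_prod_def lessThan_atLeast0[symmetric] sum_lessThan_double)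
  have Ab_select: "(Ab *\<^sub>v xb) $ r = - (\<Sum>i<N. of_bool (r \<in> J i) * xb $ i)"
    if "xb \<in> carrier_vec N" "r < m" for xb r
    using that
    unfolding sum_negf[symmetric]
    by (simp add: defs scalar_prod_def lessThan_atLeast0[symmetric] del: sum_negf)
  have Ab_sum: "(Ab *\<^sub>v xb) $ m = 0" "(Ab *\<^sub>v xb) $ Suc m = (\<Sum>i<N. xb $ i)"
    if "xb \<in> carrier_vec N" for xb
    using that by (auto simp: defs scalar_prod_def lessThan_atLeast0[symmetric])
  have constraint: "Ac *\<^sub>v xc + Ab *\<^sub>v xb = b \<longleftrightarrow>
      (\<forall>r<m. xc $ r + xc $ (m + r) + 2 = (\<Sum>i<N. of_bool (r \<in> J i) * (xb $ i + 1))) \<and>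
      (\<Sum>j<m. xc $ j) = 2 - real m \<and> (\<Sum>i<N. xb $ i) = 2 - real N"
    if xc: "xc \<in> carrier_vec (2 * m)" and xb: "xb \<in> carrier_vec N" for xc xb
  proof -
    have dims: "dim_row Ac = m + 2" "dim_row Ab = m + 2" "dim_vec b = m + 2"
      by (auto simp: defs)
    have row: "xc $ r + xc $ (m + r) - (\<Sum>i<N. of_bool (r \<in> J i) * xb $ i) =
          (\<Sum>i<N. of_bool (r \<in> J i)) - 2 \<longleftrightarrow>
        xc $ r + xc $ (m + r) + 2 = (\<Sum>i<N. of_bool (r \<in> J i) * (xb $ i + 1))" for r
      unfolding distrib_left sum.distrib mult_1_right by linarith
    have "Ac *\<^sub>v xc + Ab *\<^sub>v xb = b \<longleftrightarrow>
        (\<forall>r<m + 2. (Ac *\<^sub>v xc) $ r + (Ab *\<^sub>v xb) $ r = b $ r)"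
      by (simp add: vec_eq_iff dims del: index_mult_mat_vec)
    also have "\<dots> \<longleftrightarrow> (\<forall>r<m. (Ac *\<^sub>v xc) $ r + (Ab *\<^sub>v xb) $ r = b $ r) \<and>
        (Ac *\<^sub>v xc) $ m + (Ab *\<^sub>v xb) $ m = b $ m \<and>
        (Ac *\<^sub>v xc) $ Suc m + (Ab *\<^sub>v xb) $ Suc m = b $ Suc m"
      by (auto simp: less_Suc_eq simp del: index_mult_mat_vec)
    also have "\<dots> \<longleftrightarrow> (\<forall>r<m. xc $ r + xc $ (m + r) - (\<Sum>i<N. of_bool (r \<in> J i) * xb $ i) =
        (\<Sum>i<N. of_bool (r \<in> J i)) - 2) \<and>
        (\<Sum>j<m. xc $ j) = 2 - real m \<and> (\<Sum>i<N. xb $ i) = 2 - real N"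
      using xc xb
      by (simp add: Ac_slack Ac_sum Ab_select Ab_sum b_def del: index_mult_mat_vec)
    finally show ?thesis
      unfolding row .
  qed
  \<comment> \<open>Both inclusions below work with this matrix-free description.\<close>
  have zonotope: "hybrid_zonotope Gc Gb c Ac Ab b =
      {vec n (\<lambda>r. \<Sum>j<m. (xc $ j + 1) / 2 * w j $ r) | xc xb.
        xc \<in> carrier_vec (2 * m) \<and> (\<forall>j<2 * m. xc $ j \<in> {-1..1}) \<and>
        xb \<in> carrier_vec N \<and> (\<forall>i<N. xb $ i \<in> {-1, 1}) \<and>
        (\<forall>r<m. xc $ r + xc $ (m + r) + 2 = (\<Sum>i<N. of_bool (r \<in> J i) * (xb $ i + 1))) \<and>
        (\<Sum>j<m. xc $ j) = 2 - real m \<and> (\<Sum>i<N. xb $ i) = 2 - real N}"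
  proof -
    have dims: "dim_col Gc = 2 * m" "dim_col Gb = N"
      by (auto simp: defs)
    show ?thesis
      unfolding hybrid_zonotope_def dims
      by (intro Collect_cong ex_cong1 iffI; elim conjE)
         (simp_all only: point constraint simp_thms, simp_all)
  qed
  have "(\<Union>i<N. convex_combinations n w (J i)) = hybrid_zonotope Gc Gb c Ac Ab b"
  proof (intro subset_antisym subsetI)
    fix x assume "x \<in> (\<Union>i<N. convex_combinations n w (J i))"
    then obtain i \<mu> where i: "i < N" and \<mu>: "\<And>j. j \<in> J i \<Longrightarrow> 0 \<le> \<mu> j" "sum \<mu> (J i) = 1"
      and x: "x = vec n (\<lambda>r. \<Sum>j\<in>J i. \<mu> j * w j $ r)"
      unfolding convex_combinations_def by auto
    have Ji: "J i \<subseteq> {..<m}" "finite (J i)"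
      using J[OF i] finite_subset by auto
    \<comment> \<open>This bound keeps the slack \<open>1 - \<mu> j\<close> nonnegative.\<close>
    have \<mu>1: "\<mu> j \<le> 1" if "j \<in> J i" for j
      using member_le_sum[of j "J i" \<mu>] that \<mu> Ji by auto
    define \<mu>' where "\<mu>' j = (if j \<in> J i then \<mu> j else 0)" for j
    have sum_\<mu>': "(\<Sum>j<m. \<mu>' j * h j) = (\<Sum>j\<in>J i. \<mu> j * h j)" for h
      using Ji by (intro sum.mono_neutral_cong_right) (auto simp: \<mu>'_def)
    \<comment> \<open>Each value t in [0,1] is encoded as 2t - 1. The slack is
      \<open>1 - \<mu> j\<close> on \<open>J i\<close> and 0 elsewhere, which is what the selector
      \<open>i\<close> demands.\<close>
    define xc where "xc = vec (2 * m) (\<lambda>j.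
      if j < m then 2 * \<mu>' j - 1 else 2 * (of_bool (j - m \<in> J i) - \<mu>' (j - m)) - 1)"
    define xb :: "real vec" where "xb = vec N (\<lambda>k. 2 * of_bool (k = i) - 1)"
    have select: "(\<Sum>k<N. of_bool (r \<in> J k) * (xb $ k + 1)) = 2 * of_bool (r \<in> J i)" for r
    proof -
      have "(\<Sum>k<N. of_bool (r \<in> J k) * (xb $ k + 1)) =
          (\<Sum>k<N. if k = i then 2 * of_bool (r \<in> J i) else 0)"
        by (intro sum.cong) (auto simp: xb_def)
      then show ?thesis using i by simp
    qed
    have "x = vec n (\<lambda>r. \<Sum>j<m. (xc $ j + 1) / 2 * w j $ r)"
      unfolding x sum_\<mu>'[symmetric] by (auto simp: xc_def intro!: eq_vecI sum.cong)
    moreover have "\<forall>j<2 * m. xc $ j \<in> {-1..1}"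
      using \<mu> \<mu>1 by (auto simp: xc_def \<mu>'_def)
    moreover have "\<forall>r<m. xc $ r + xc $ (m + r) + 2 =
        (\<Sum>i<N. of_bool (r \<in> J i) * (xb $ i + 1))"
      unfolding select by (auto simp: xc_def)
    moreover have "(\<Sum>j<m. xc $ j) = 2 - real m"
    proof -
      have "(\<Sum>j<m. xc $ j) = (\<Sum>j<m. 2 * \<mu>' j - 1)"
        by (intro sum.cong) (auto simp: xc_def)
      then show ?thesis
        using sum_\<mu>'[of "\<lambda>_. 1"] \<mu> by (simp add: sum_subtractf sum_distrib_left[symmetric])
    qed
    moreover have "(\<Sum>k<N. xb $ k) = 2 - real N"
      using i by (simp add: xb_def sum_subtractf sum_distrib_left[symmetric] of_bool_def)
    moreover have "xc \<in> carrier_vec (2 * m)" "xb \<in> carrier_vec N" "\<forall>i<N. xb $ i \<in> {-1, 1}"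
      by (auto simp: xc_def xb_def)
    ultimately show "x \<in> hybrid_zonotope Gc Gb c Ac Ab b"
      unfolding zonotope by blast
  next
    fix x assume "x \<in> hybrid_zonotope Gc Gb c Ac Ab b"
    then obtain xc xb where x: "x = vec n (\<lambda>r. \<Sum>j<m. (xc $ j + 1) / 2 * w j $ r)"
      and xc: "\<And>j. j < 2 * m \<Longrightarrow> xc $ j \<in> {-1..1}"
      and xb: "\<And>i. i < N \<Longrightarrow> xb $ i \<in> {-1, 1}"
      and slack: "\<And>r. r < m \<Longrightarrow>
        xc $ r + xc $ (m + r) + 2 = (\<Sum>i<N. of_bool (r \<in> J i) * (xb $ i + 1))"
      and sums: "(\<Sum>j<m. xc $ j) = 2 - real m" "(\<Sum>i<N. xb $ i) = 2 - real N"
      unfolding zonotope by blast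
    obtain i where i: "i < N" and xb_i: "\<And>k. k < N \<Longrightarrow> xb $ k = 2 * of_bool (k = i) - 1"
      using signs_sum_singleton[of N "\<lambda>i. xb $ i"] xb sums(2) by blast
    define \<mu> where "\<mu> j = (xc $ j + 1) / 2" for j
    have \<mu>_nonneg: "0 \<le> \<mu> j" if "j < m" for j
      using xc[of j] that by (auto simp: \<mu>_def)
    \<comment> \<open>Off \<open>J i\<close> no active selector contributes, so
      \<open>xc $ j + xc $ (m + j) = -2\<close>. Both factors are at least -1, so both equal -1 and
      the weight vanishes.\<close>
    have \<mu>_zero: "\<mu> j = 0" if "j < m" "j \<notin> J i" for j
    proof -
      have "(\<Sum>k<N. of_bool (j \<in> J k) * (xb $ k + 1)) = 0"
        using that by (intro sum.neutral) (auto simp: xb_i)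
      then show ?thesis
        using slack[of j] xc[of j] xc[of "m + j"] that by (auto simp: \<mu>_def)
    qed
    have restrict: "(\<Sum>j<m. \<mu> j * h j) = (\<Sum>j\<in>J i. \<mu> j * h j)" for h
      using J[OF i] \<mu>_zero by (intro sum.mono_neutral_right) auto
    have "(\<Sum>j<m. \<mu> j) = 1"
      using sums(1) by (simp add: \<mu>_def sum_divide_distrib[symmetric] sum.distrib)
    then have "sum \<mu> (J i) = 1"
      using restrict[of "\<lambda>_. 1"] by simp
    moreover have "x = vec n (\<lambda>r. \<Sum>j\<in>J i. \<mu> j * w j $ r)"
      unfolding x \<mu>_def[symmetric] restrict ..
    moreover have "\<forall>j\<in>J i. 0 \<le> \<mu> j"
      using J[OF i] \<mu>_nonneg by auto
    ultimately show "x \<in> (\<Union>i<N. convex_combinations n w (J i))"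
      unfolding convex_combinations_def using i by blast
  qed
  moreover have "Gc \<in> carrier_mat n (2 * m)" "Gb \<in> carrier_mat n N" "c \<in> carrier_vec n"
    "Ac \<in> carrier_mat (m + 2) (2 * m)" "Ab \<in> carrier_mat (m + 2) N" "b \<in> carrier_vec (m + 2)"
    by (auto simp: defs)
  ultimately show ?thesis
    by blast
qed

theorem theorem5:
  fixes n nv N :: nat
    and v :: "nat \<Rightarrow> real vec"
    and P :: "nat \<Rightarrow> real vec set"
    and S :: "real vec set"
  assumes points: "\<And>j. j \<in> {1..nv} \<Longrightarrow> v j \<in> carrier_vec n"
    and polytopes: "\<And>i. i \<in> {1..N} \<Longrightarrow>
      \<exists>k. \<exists>V \<in> carrier_mat n k. set (cols V) \<subseteq> v ` {1..nv} \<and> P i = vrep_polytope V"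
    and union: "S = (\<Union>i \<in> {1..N}. P i)"
  shows "\<exists>ng nb nc. ng = 2 * nv \<and> nb = N \<and> nc = nv + 2 \<and>
    (\<exists>Gc \<in> carrier_mat n ng. \<exists>Gb \<in> carrier_mat n nb. \<exists>c \<in> carrier_vec n.
     \<exists>Ac \<in> carrier_mat nc ng. \<exists>Ab \<in> carrier_mat nc nb. \<exists>b \<in> carrier_vec nc.
       S = hybrid_zonotope Gc Gb c Ac Ab b)"
proof -
  \<comment> \<open>The given points and polytopes are numbered from 1, the matrix columns from 0;
    hence the shift by \<open>Suc\<close> here and in \<open>P (Suc i)\<close>.\<close>
  define w where "w j = v (Suc j)" for j
  have "\<exists>J \<subseteq> {..<nv}. P (Suc i) = convex_combinations n w J" if "i < N" for i
  proof -
    obtain k V where V: "V \<in> carrier_mat n k" "set (cols V) \<subseteq> v ` {1..nv}"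
      and P: "P (Suc i) = vrep_polytope V"
      using polytopes[of "Suc i"] \<open>i < N\<close> by auto
    have "set (cols V) \<subseteq> w ` {..<nv}"
      using V(2) unfolding w_def
      by (auto simp: image_iff subset_iff Bex_def) (metis Suc_le_eq Suc_pred less_eq_Suc_le)
    then show ?thesis
      using vrep_polytope_eq_convex_combinations_if_cols[OF V(1)] P
      by (intro exI[of _ "{j \<in> {..<nv}. w j \<in> set (cols V)}"]) auto
  qed
  then obtain J where J: "\<And>i. i < N \<Longrightarrow> J i \<subseteq> {..<nv}"
    "\<And>i. i < N \<Longrightarrow> P (Suc i) = convex_combinations n w (J i)"
    by metis
  have "S = (\<Union>i<N. convex_combinations n w (J i))"
    unfolding union image_Suc_lessThan[symmetric] using J(2) by auto
  then show ?thesis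
    using Union_convex_combinations_eq_hybrid_zonotope[of N J nv n w] J(1) by auto
qed

end
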